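(* Let $\mathbb{X}$ be a real reflexive Banach space and $\mathbb{Y}$ any real Banach space. Let $T,A:\mathbb{X}\to\mathbb{Y}$ be compact linear operators. Suppose that either (i) or (ii) holds: (i) $M_T$ is a connected subset of $S_{\mathbb{X}}$; (ii) $M_T$ is not connected but $M_T=D\cup(-D)$, where $D$ is a non-empty connected subset of $S_{\mathbb{X}}$. Then $T\perp_B A$ if and only if there exists $x\in M_T$ such that $Tx\perp_B Ax$.
   Context: All normed spaces are real. $S_{\mathbb{X}}=\{x\in\mathbb{X}:\|x\|=1\}$ is the unit sphere. For a bounded linear operator $T:\mathbb{X}\to\mathbb{Y}$, $M_T=\{x\in S_{\mathbb{X}}:\|Tx\|=\|T\|\}$ is its norm attainment set, where $\|T\|$ is the operator norm. Birkhoff-James orthogonality: for elements $x,y$ of a normed space, $x\perp_B y$ means $\|x+\lambda y\|\ge\|x\|$ for all $\lambda\in\mathbb{R}$; $T\perp_B A$ is understood in the space of bounded linear operators with the operator norm. *)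

theory Defs
  imports "HOL-Analysis.Analysis"
begin

definition canonical_embedding :: "'a::real_normed_vector \<Rightarrow> (('a \<Rightarrow>\<^sub>L real) \<Rightarrow>\<^sub>L real)" where
  "canonical_embedding x = Blinfun (\<lambda>f. blinfun_apply f x)"

(* Blinfun is only specified on bounded linear maps; evaluation at x is one. *)
lemma canonical_embedding_apply [simp]:
  "blinfun_apply (canonical_embedding x) f = blinfun_apply f x"
  unfolding canonical_embedding_def
  by (simp add: bounded_linear_Blinfun_apply blinfun.bounded_linear_left)

definition reflexive_space :: "'a::real_normed_vector itself \<Rightarrow> bool" where
  "reflexive_space _ \<longleftrightarrow> surj (canonical_embedding :: 'a \<Rightarrow> (('a \<Rightarrow>\<^sub>L real) \<Rightarrow>\<^sub>L real))"

definition compact_operator :: "('a::real_normed_vector \<Rightarrow>\<^sub>L 'b::real_normed_vector) \<Rightarrow> bool" where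
  "compact_operator T \<longleftrightarrow> (\<forall>B. bounded B \<longrightarrow> compact (closure (blinfun_apply T ` B)))"

definition norm_attainment_set :: "('a::real_normed_vector \<Rightarrow>\<^sub>L 'b::real_normed_vector) \<Rightarrow> 'a set" where
  "norm_attainment_set T = {x \<in> sphere 0 1. norm (blinfun_apply T x) = norm T}"

definition birkhoff_orthogonal :: "'a::real_normed_vector \<Rightarrow> 'a \<Rightarrow> bool" (infix "\<bottom>\<^sub>B" 50) where
  "x \<bottom>\<^sub>B y \<longleftrightarrow> (\<forall>c::real. norm (x + c *\<^sub>R y) \<ge> norm x)"

end

theory Submission
  imports Defs
begin

text \<open>Compactness and reflexivity turn almost maximizing unit vectors of \<open>T + A/n\<close> into a vector
  \<open>x\<close> in \<open>M\<^sub>T\<close> with \<open>\<parallel>Tx + cAx\<parallel> \<ge> \<parallel>Tx\<parallel>\<close> for all \<open>c \<ge> 0\<close>; the same for \<open>-A\<close> handles \<open>c \<le> 0\<close>.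
  By convexity, the vectors of \<open>M\<^sub>T\<close> with the first property and those with the second are two
  closed sets that cover \<open>M\<^sub>T\<close>, and both are invariant under \<open>x \<mapsto> -x\<close>. Connectedness of \<open>M\<^sub>T\<close> or
  of \<open>D\<close> hence makes them meet.\<close>

section \<open>Sublinear functionals and the Hahn--Banach theorem\<close>

definition sublinear :: "('v::real_vector \<Rightarrow> real) \<Rightarrow> bool" where
  "sublinear p \<longleftrightarrow> (\<forall>x y. p (x + y) \<le> p x + p y) \<and> (\<forall>t x. t \<ge> 0 \<longrightarrow> p (t *\<^sub>R x) = t * p x)"

lemma sublinear_add: "sublinear p \<Longrightarrow> p (x + y) \<le> p x + p y"
  by (simp add: sublinear_def)

lemma sublinear_scale: "sublinear p \<Longrightarrow> t \<ge> 0 \<Longrightarrow> p (t *\<^sub>R x) = t * p x"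
  by (simp add: sublinear_def)

lemma sublinear_zero: "sublinear p \<Longrightarrow> p 0 = 0"
  using sublinear_scale[of p 0 0] by simp

lemma sublinear_minus: "sublinear p \<Longrightarrow> - p (- x) \<le> p x"
  using sublinear_add[of p x "- x"] sublinear_zero[of p] by simp

text \<open>The one-sided bound at \<open>inverse t\<close> and \<open>t *\<^sub>R x\<close>
  reverses the bound at \<open>t\<close>, so homogeneity needs checking in one direction
  only.\<close>

lemma sublinearI:
  assumes add: "\<And>x y. p (x + y) \<le> p x + p y"
    and zero: "p 0 = 0"
    and scale: "\<And>t x. t > 0 \<Longrightarrow> p (t *\<^sub>R x) \<le> t * p x"
  shows "sublinear p"
  unfolding sublinear_def
proof (intro conjI allI impI add)
  fix t :: real and x
  assume "t \<ge> 0"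
  show "p (t *\<^sub>R x) = t * p x"
  proof (cases "t = 0")
    case False
    with \<open>t \<ge> 0\<close> have "t > 0" by simp
    then have "p x \<le> p (t *\<^sub>R x) / t"
      using scale[of "inverse t" "t *\<^sub>R x"] by (simp add: field_simps)
    with \<open>t > 0\<close> scale[of t x] show ?thesis by (simp add: field_simps)
  qed (simp add: zero)
qed

lemma sublinear_norm: "sublinear norm"
  by (rule sublinearI) (auto intro: norm_triangle_ineq)

text \<open>The auxiliary functional from the minimality proof of Hahn--Banach: it lies below
  \<open>p\<close>, and \<open>t = 1\<close> bounds its value at \<open>- y\<close> by
  \<open>- p y\<close>. A linear functional below it must therefore take the value
  \<open>p y\<close> at \<open>y\<close>.\<close>

definition sublinear_tilt :: "('v::real_vector \<Rightarrow> real) \<Rightarrow> 'v \<Rightarrow> 'v \<Rightarrow> real" where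
  "sublinear_tilt p y x = (INF t\<in>{0..}. p (x + t *\<^sub>R y) - t * p y)"

text \<open>Subadditivity applied to \<open>t *\<^sub>R y = (x + t *\<^sub>R y) + (- x)\<close>. It
  bounds the family from below uniformly in \<open>t\<close>, so that the real infimum in the tilt
  is a genuine one.\<close>

lemma sublinear_tilt_lower:
  assumes "sublinear p" "t \<ge> 0"
  shows "- p (- x) \<le> p (x + t *\<^sub>R y) - t * p y"
  using sublinear_add[of p "x + t *\<^sub>R y" "- x"] sublinear_scale[of p t y] assms by simp

lemma sublinear_tilt_le:
  assumes "sublinear p" "t \<ge> 0"
  shows "sublinear_tilt p y x \<le> p (x + t *\<^sub>R y) - t * p y"
  unfolding sublinear_tilt_def
  by (rule cINF_lower) (use assms sublinear_tilt_lower[OF assms(1)] in \<open>auto intro!: bdd_belowI2\<close>)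

lemma sublinear_tilt_greatest:
  assumes "\<And>t. t \<ge> 0 \<Longrightarrow> c \<le> p (x + t *\<^sub>R y) - t * p y"
  shows "c \<le> sublinear_tilt p y x"
  unfolding sublinear_tilt_def by (rule cINF_greatest) (use assms in auto)

lemma sublinear_sublinear_tilt:
  assumes p: "sublinear p"
  shows "sublinear (sublinear_tilt p y)"
proof (rule sublinearI)
  fix x x'
  \<comment> \<open>The parameters add: \<open>t\<close> for \<open>x\<close> and \<open>t'\<close>
    for \<open>x'\<close> give \<open>t + t'\<close> for the sum. The infimum is taken over
    \<open>t'\<close> with \<open>t\<close> fixed, and afterwards over \<open>t\<close>.\<close>
  have "sublinear_tilt p y (x + x') - (p (x + t *\<^sub>R y) - t * p y) \<le> sublinear_tilt p y x'"
    if t: "t \<ge> 0" for t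
  proof (rule sublinear_tilt_greatest)
    fix t' :: real
    assume "t' \<ge> 0"
    with t have "sublinear_tilt p y (x + x') \<le> p ((x + x') + (t + t') *\<^sub>R y) - (t + t') * p y"
      by (intro sublinear_tilt_le[OF p]) auto
    also have "(x + x') + (t + t') *\<^sub>R y = (x + t *\<^sub>R y) + (x' + t' *\<^sub>R y)"
      by (simp add: algebra_simps)
    finally show "sublinear_tilt p y (x + x') - (p (x + t *\<^sub>R y) - t * p y)
        \<le> p (x' + t' *\<^sub>R y) - t' * p y"
      using sublinear_add[OF p, of "x + t *\<^sub>R y" "x' + t' *\<^sub>R y"] by (simp add: algebra_simps)
  qed
  then have "sublinear_tilt p y (x + x') - sublinear_tilt p y x' \<le> sublinear_tilt p y x"
    by (intro sublinear_tilt_greatest) (simp add: algebra_simps)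
  then show "sublinear_tilt p y (x + x') \<le> sublinear_tilt p y x + sublinear_tilt p y x'"
    by simp
next
  have "0 \<le> sublinear_tilt p y 0"
    by (rule sublinear_tilt_greatest) (simp add: sublinear_scale[OF p])
  moreover have "sublinear_tilt p y 0 \<le> 0"
    using sublinear_tilt_le[OF p, of 0 y 0] sublinear_zero[OF p] by simp
  ultimately show "sublinear_tilt p y 0 = 0" by simp
next
  fix s :: real and x
  assume s: "s > 0"
  have "sublinear_tilt p y (s *\<^sub>R x) / s \<le> sublinear_tilt p y x"
  proof (rule sublinear_tilt_greatest)
    fix t :: real
    assume "t \<ge> 0"
    then have "sublinear_tilt p y (s *\<^sub>R x) \<le> p (s *\<^sub>R x + (s * t) *\<^sub>R y) - s * t * p y"
      using s by (intro sublinear_tilt_le[OF p]) auto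
    also have "s *\<^sub>R x + (s * t) *\<^sub>R y = s *\<^sub>R (x + t *\<^sub>R y)"
      by (simp add: algebra_simps)
    also have "p \<dots> = s * p (x + t *\<^sub>R y)"
      using s by (simp add: sublinear_scale[OF p])
    finally show "sublinear_tilt p y (s *\<^sub>R x) / s \<le> p (x + t *\<^sub>R y) - t * p y"
      using s by (simp add: field_simps)
  qed
  then show "sublinear_tilt p y (s *\<^sub>R x) \<le> s * sublinear_tilt p y x"
    using s by (simp add: field_simps)
qed

text \<open>Supplies the lower bounds for Zorn's lemma. The common majorant \<open>p\<close> keeps
  the infimum finite, since \<open>f x \<ge> - f (- x) \<ge> - p (- x)\<close>. Subadditivity rests
  on the chain condition.\<close>

lemma sublinear_Inf_chain:
  fixes C :: "('v::real_vector \<Rightarrow> real) set"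
  assumes ne: "C \<noteq> {}" and sub: "\<And>f. f \<in> C \<Longrightarrow> sublinear f" and le: "\<And>f. f \<in> C \<Longrightarrow> f \<le> p"
    and chain: "\<And>f g. f \<in> C \<Longrightarrow> g \<in> C \<Longrightarrow> f \<le> g \<or> g \<le> f"
  shows "sublinear (\<lambda>x. INF f\<in>C. f x)"
    and "\<And>f. f \<in> C \<Longrightarrow> (\<lambda>x. INF f\<in>C. f x) \<le> f"
proof -
  have bdd: "bdd_below ((\<lambda>f. f x) ` C)" for x
  proof (rule bdd_belowI2)
    fix f
    assume "f \<in> C"
    then show "- p (- x) \<le> f x"
      using sublinear_minus[OF sub, of f x] le_funD[OF le, of f "- x"] by linarith
  qed
  have lower: "(INF f\<in>C. f x) \<le> f x" if "f \<in> C" for f x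
    by (rule cINF_lower[OF bdd that])
  then show "\<And>f. f \<in> C \<Longrightarrow> (\<lambda>x. INF f\<in>C. f x) \<le> f"
    by (simp add: le_fun_def)
  show "sublinear (\<lambda>x. INF f\<in>C. f x)"
  proof (rule sublinearI)
    fix x y
    \<comment> \<open>The two infima may be approached by different members of \<open>C\<close>; the
      smaller of the two members serves for both.\<close>
    have add_le: "(INF f\<in>C. f (x + y)) \<le> f x + g y" if fg: "f \<in> C" "g \<in> C" for f g
    proof -
      obtain h where "h \<in> C" "h \<le> f" "h \<le> g"
        using chain[OF fg] fg by blast
      then show ?thesis
        using lower[of h "x + y"] sublinear_add[OF sub, of h x y]
        by (smt (verit) le_fun_def)
    qed
    have "(INF f\<in>C. f (x + y)) - f x \<le> (INF g\<in>C. g y)" if "f \<in> C" for f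
      by (rule cINF_greatest[OF ne]) (use add_le[OF that] in \<open>simp add: algebra_simps\<close>)
    then have "(INF f\<in>C. f (x + y)) - (INF g\<in>C. g y) \<le> (INF f\<in>C. f x)"
      by (intro cINF_greatest ne) (simp add: algebra_simps)
    then show "(INF f\<in>C. f (x + y)) \<le> (INF f\<in>C. f x) + (INF f\<in>C. f y)"
      by simp
  next
    show "(INF f\<in>C. f 0) = 0"
      using ne by (simp add: sublinear_zero[OF sub])
  next
    fix t :: real and x
    assume t: "t > 0"
    have "(INF f\<in>C. f (t *\<^sub>R x)) / t \<le> (INF f\<in>C. f x)"
    proof (rule cINF_greatest[OF ne])
      fix f
      assume "f \<in> C"
      then show "(INF f\<in>C. f (t *\<^sub>R x)) / t \<le> f x"
        using lower[of f "t *\<^sub>R x"] sublinear_scale[OF sub, of f t x] t by (simp add: field_simps)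
    qed
    then show "(INF f\<in>C. f (t *\<^sub>R x)) \<le> t * (INF f\<in>C. f x)"
      using t by (simp add: field_simps)
  qed
qed

text \<open>A minimal sublinear functional equals all its tilts, which forces superadditivity.\<close>

theorem sublinear_dominates_linear:
  fixes p :: "'v::real_vector \<Rightarrow> real"
  assumes p: "sublinear p"
  shows "\<exists>F. linear F \<and> (\<forall>x. F x \<le> p x)"
proof -
  define S where "S = {q. sublinear q \<and> q \<le> p}"
  \<comment> \<open>Zorn's lemma for the reversed pointwise order: a maximal element there is a
    minimal sublinear functional below \<open>p\<close>.\<close>
  have "\<exists>m\<in>S. \<forall>a\<in>S. a \<le> m \<longrightarrow> a = m"
  proof (rule predicate_Zorn)
    show "partial_order_on S (relation_of (\<lambda>f g. g \<le> f) S)"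
      by (rule partial_order_on_relation_ofI) auto
  next
    fix C
    assume C: "C \<in> Chains (relation_of (\<lambda>f g. g \<le> f) S)"
    then have CS: "f \<in> S \<and> (f \<le> g \<or> g \<le> f)" if "f \<in> C" "g \<in> C" for f g
      using that by (auto simp: Chains_def relation_of_def)
    show "\<exists>u\<in>S. \<forall>a\<in>C. u \<le> a"
    \<comment> \<open>The infimum over an empty chain carries no information, so \<open>p\<close>
      itself is the bound in that case.\<close>
    proof (cases "C = {}")
      case True
      with p show ?thesis by (auto simp: S_def)
    next
      case False
      define u where "u = (\<lambda>x. INF f\<in>C. f x)"
      have "sublinear u" "\<And>f. f \<in> C \<Longrightarrow> u \<le> f"
        unfolding u_def using sublinear_Inf_chain[of C p] False CS by (auto simp: S_def)
      moreover have "u \<le> p"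
        using False CS calculation(2) by (force simp: S_def intro: order_trans)
      ultimately show ?thesis by (auto simp: S_def)
    qed
  qed
  then obtain m where m: "sublinear m" "m \<le> p" and min: "\<And>q. q \<in> S \<Longrightarrow> q \<le> m \<Longrightarrow> q = m"
    by (auto simp: S_def)
  have tilt: "sublinear_tilt m y = m" for y
  proof (rule min)
    show le: "sublinear_tilt m y \<le> m"
      using sublinear_tilt_le[OF m(1), of 0 y] by (simp add: le_fun_def)
    show "sublinear_tilt m y \<in> S"
      using sublinear_sublinear_tilt[OF m(1)] order_trans[OF le m(2)] by (simp add: S_def)
  qed
  have add: "m (x + y) = m x + m y" for x y
    using sublinear_tilt_le[OF m(1), of 1 y x] sublinear_add[OF m(1), of x y] by (simp add: tilt)
  have neg: "m (- x) = - m x" for x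
    using add[of x "- x"] sublinear_zero[OF m(1)] by simp
  have "linear m"
  proof (rule linearI)
    fix t :: real and x
    show "m (t *\<^sub>R x) = t *\<^sub>R m x"
      using sublinear_scale[OF m(1), of t x] sublinear_scale[OF m(1), of "- t" x] neg[of "t *\<^sub>R x"]
      by (cases "t \<ge> 0") auto
  qed (rule add)
  with m(2) show ?thesis by (auto simp: le_fun_def)
qed

section \<open>Bounded functionals obtained from domination\<close>

lemma linear_dominated_bounded_linear:
  fixes F :: "'v::real_normed_vector \<Rightarrow> real"
  assumes F: "linear F" and le: "\<And>x. F x \<le> r * norm x"
  shows "bounded_linear F" and "\<And>x. \<bar>F x\<bar> \<le> r * norm x"
proof -
  show abs: "\<bar>F x\<bar> \<le> r * norm x" for x
    using le[of x] le[of "- x"] by (simp add: linear_neg[OF F] abs_le_iff)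
  show "bounded_linear F"
    by (rule bounded_linear.intro[OF F], unfold_locales)
      (use abs in \<open>auto intro!: exI[of _ r] simp: mult.commute\<close>)
qed

text \<open>Dominating the tilt of the norm at \<open>x\<close>, instead of the norm, forces the
  value at \<open>x\<close>: the tilt is at most \<open>- norm x\<close> at \<open>- x\<close>. No
  extension from the line through \<open>x\<close> is involved. The bound \<open>\<le> 1\<close>
  also covers the zero space.\<close>

corollary norming_functional:
  fixes x :: "'v::real_normed_vector"
  shows "\<exists>f :: 'v \<Rightarrow>\<^sub>L real. norm f \<le> 1 \<and> blinfun_apply f x = norm x"
proof -
  have tilt_le: "sublinear_tilt norm x z \<le> norm z" for z
    using sublinear_tilt_le[OF sublinear_norm, of 0 x z] by simp
  obtain F where F: "linear F" "\<And>z. F z \<le> sublinear_tilt norm x z"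
    using sublinear_dominates_linear[OF sublinear_sublinear_tilt[OF sublinear_norm]] by blast
  have le: "F z \<le> 1 * norm z" for z
    using F(2)[of z] tilt_le[of z] by simp
  note bl = linear_dominated_bounded_linear[OF F(1) le]
  have "F (- x) \<le> - norm x"
    using F(2)[of "- x"] sublinear_tilt_le[OF sublinear_norm, of 1 x "- x"] by simp
  then have "F x = norm x"
    using le[of x] by (simp add: linear_neg[OF F(1)])
  moreover have "norm (Blinfun F) \<le> 1"
    by (rule norm_blinfun_bound) (use bl in \<open>auto simp: bounded_linear_Blinfun_apply\<close>)
  ultimately show ?thesis
    using bl(1) by (auto intro!: exI[of _ "Blinfun F"] simp: bounded_linear_Blinfun_apply)
qed

section \<open>Compact operators on reflexive spaces\<close>

text \<open>A linear functional dominated by \<open>f \<mapsto> limsup f(x\<^sub>n)\<close> is represented by the desired point.\<close>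

lemma reflexive_weak_cluster_point:
  fixes x :: "nat \<Rightarrow> 'a::real_normed_vector"
  assumes reflexive: "reflexive_space TYPE('a)" and bound: "\<And>n. norm (x n) \<le> r"
  shows "\<exists>z. norm z \<le> r \<and> (\<forall>(f :: 'a \<Rightarrow>\<^sub>L real) l. (\<lambda>n. blinfun_apply f (x n)) \<longlonglongrightarrow> l \<longrightarrow> blinfun_apply f z = l)"
proof -
  \<comment> \<open>\<open>U f\<close> holds the eventual upper bounds of the values
    \<open>f (x n)\<close>, so \<open>p f\<close> is their limsup as a real number. The bounds by
    \<open>r * norm f\<close> make \<open>U f\<close> nonempty and bounded below, as
    \<open>Inf\<close> requires.\<close>
  define U where "U f = {c. \<forall>\<^sub>F n in sequentially. blinfun_apply f (x n) \<le> c}" for f :: "'a \<Rightarrow>\<^sub>L real"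
  define p where "p f = Inf (U f)" for f
  have abs_le: "\<bar>blinfun_apply f (x n)\<bar> \<le> r * norm f" for f :: "'a \<Rightarrow>\<^sub>L real" and n
  proof -
    have "\<bar>blinfun_apply f (x n)\<bar> \<le> norm f * norm (x n)"
      using norm_blinfun[of f "x n"] by simp
    also have "\<dots> \<le> norm f * r"
      by (intro mult_left_mono bound) simp
    finally show ?thesis by (simp add: mult.commute)
  qed
  have U_mem: "r * norm f \<in> U f" for f
    unfolding U_def using abs_le[of f] by (auto intro!: always_eventually simp: abs_le_iff)
  then have U_ne: "U f \<noteq> {}" for f
    by blast
  have U_lower: "- (r * norm f) \<le> c" if c: "c \<in> U f" for f c
  proof -
    obtain n where "blinfun_apply f (x n) \<le> c"
      using c unfolding U_def by (auto simp: eventually_sequentially)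
    with abs_le[of f n] show ?thesis by linarith
  qed
  have p_le: "p f \<le> c" if "c \<in> U f" for f c
    unfolding p_def using that U_lower by (intro cInf_lower bdd_belowI) auto
  have p_ge: "c \<le> p f" if "\<And>d. d \<in> U f \<Longrightarrow> c \<le> d" for f c
    unfolding p_def by (rule cInf_greatest[OF U_ne that])
  have "sublinear p"
  proof (rule sublinearI)
    fix f g
    have add_le: "p (f + g) \<le> c + d" if "c \<in> U f" "d \<in> U g" for c d
    proof (rule p_le)
      have "\<forall>\<^sub>F n in sequentially. f (x n) \<le> c" "\<forall>\<^sub>F n in sequentially. g (x n) \<le> d"
        using that by (auto simp: U_def)
      then have "\<forall>\<^sub>F n in sequentially. (f + g) (x n) \<le> c + d"
        by eventually_elim (simp add: blinfun.add_left)
      then show "c + d \<in> U (f + g)" by (simp add: U_def)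
    qed
    have "p (f + g) - c \<le> p g" if "c \<in> U f" for c
      by (rule p_ge) (use add_le[OF that] in \<open>simp add: algebra_simps\<close>)
    then have "p (f + g) - p g \<le> p f"
      by (intro p_ge) (simp add: algebra_simps)
    then show "p (f + g) \<le> p f + p g" by simp
  next
    show "p 0 = 0"
      using p_le[OF U_mem, of 0] p_ge[of 0 0] U_lower[of _ 0] by simp
  next
    fix t :: real and f
    assume t: "t > 0"
    have "p (t *\<^sub>R f) / t \<le> p f"
    proof (rule p_ge)
      fix c
      assume "c \<in> U f"
      then have "t * c \<in> U (t *\<^sub>R f)"
        using t by (simp add: U_def blinfun.scaleR_left)
      then show "p (t *\<^sub>R f) / t \<le> c"
        using p_le t by (simp add: field_simps)
    qed
    then show "p (t *\<^sub>R f) \<le> t * p f"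
      using t by (simp add: field_simps)
  qed
  then obtain F where F: "linear F" "\<And>f. F f \<le> p f"
    using sublinear_dominates_linear by blast
  have F_le: "F f \<le> r * norm f" for f
    using F(2)[of f] p_le[OF U_mem, of f] by linarith
  note bl = linear_dominated_bounded_linear[OF F(1) F_le]
  \<comment> \<open>\<open>F\<close> is bounded by \<open>r\<close> and thus an element of the
    bidual; reflexivity turns it into evaluation at \<open>z\<close>.\<close>
  obtain z where "canonical_embedding z = Blinfun F"
    using reflexive unfolding reflexive_space_def by (metis surjD)
  then have z: "blinfun_apply f z = F f" for f
    using bl(1) by (metis canonical_embedding_apply bounded_linear_Blinfun_apply)
  obtain g :: "'a \<Rightarrow>\<^sub>L real" where g: "norm g \<le> 1" "blinfun_apply g z = norm z"
    using norming_functional by blast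
  have r: "r \<ge> 0"
    using bound[of 0] norm_ge_zero[of "x 0"] by linarith
  have "norm z \<le> r * norm g"
    using F_le[of g] by (simp add: z[symmetric] g)
  also have "\<dots> \<le> r"
    using mult_left_mono[OF g(1) r] by simp
  finally have "norm z \<le> r" .
  moreover have "blinfun_apply f z = l" if lim: "(\<lambda>n. blinfun_apply f (x n)) \<longlonglongrightarrow> l" for f :: "'a \<Rightarrow>\<^sub>L real" and l
  proof -
    \<comment> \<open>A limsup does not exceed a limit. Using this for \<open>f\<close> and for
      \<open>- f\<close> bounds \<open>f z\<close> from both sides.\<close>
    have upper: "F h \<le> k" if "(\<lambda>n. blinfun_apply h (x n)) \<longlonglongrightarrow> k" for h k
    proof (rule field_le_epsilon)
      fix e :: real
      assume "e > 0"
      then have "\<forall>\<^sub>F n in sequentially. h (x n) < k + e"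
        using order_tendstoD(2)[OF that, of "k + e"] by simp
      then have "k + e \<in> U h"
        by (auto simp: U_def elim: eventually_mono)
      then show "F h \<le> k + e"
        using F(2)[of h] p_le by fastforce
    qed
    have "(\<lambda>n. blinfun_apply (- f) (x n)) \<longlonglongrightarrow> - l"
      using tendsto_minus[OF lim] by (simp add: blinfun.minus_left)
    from upper[OF this] upper[OF lim] show ?thesis
      by (simp add: z linear_neg[OF F(1)])
  qed
  ultimately show ?thesis by blast
qed

text \<open>Testing against \<open>g o\<^sub>L T\<close>, with \<open>g\<close> norming for
  \<open>T z - u\<close>, gives \<open>g (T z - u) = 0\<close>, hence the difference
  vanishes.\<close>

lemma blinfun_apply_eq_limit:
  fixes T :: "'a::real_normed_vector \<Rightarrow>\<^sub>L 'b::real_normed_vector"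
  assumes weak: "\<And>(f :: 'a \<Rightarrow>\<^sub>L real) l. (\<lambda>n. blinfun_apply f (x n)) \<longlonglongrightarrow> l \<Longrightarrow> blinfun_apply f z = l"
    and lim: "(\<lambda>n. T (x n)) \<longlonglongrightarrow> u"
  shows "T z = u"
proof -
  obtain g :: "'b \<Rightarrow>\<^sub>L real" where g: "blinfun_apply g (T z - u) = norm (T z - u)"
    using norming_functional by blast
  have "(\<lambda>n. (g o\<^sub>L T) (x n)) \<longlonglongrightarrow> g u"
    using blinfun.tendsto[OF tendsto_const lim] by simp
  from weak[OF this] have "g (T z - u) = 0"
    by (simp add: blinfun.diff_right)
  with g show ?thesis by simp
qed

lemma compact_operator_subsequence:
  fixes x :: "nat \<Rightarrow> 'a::real_normed_vector"
  assumes T: "compact_operator T" and bound: "\<And>n. norm (x n) \<le> r"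
  shows "\<exists>u s. strict_mono (s :: nat \<Rightarrow> nat) \<and> (\<lambda>n. T (x (s n))) \<longlonglongrightarrow> u"
proof -
  have "bounded (range x)"
    using bound by (auto simp: bounded_iff)
  then have "seq_compact (closure (blinfun_apply T ` range x))"
    using T by (simp add: compact_operator_def compact_imp_seq_compact)
  moreover have "\<forall>n. T (x n) \<in> closure (blinfun_apply T ` range x)"
    by (auto intro: closure_subset[THEN subsetD])
  ultimately obtain u s where "strict_mono (s :: nat \<Rightarrow> nat)" "((\<lambda>n. T (x n)) \<circ> s) \<longlonglongrightarrow> u"
    by (rule seq_compactE)
  then show ?thesis by (auto simp: o_def)
qed

lemma compact_operator_uminus:
  assumes "compact_operator A"
  shows "compact_operator (- A)"
  unfolding compact_operator_def
proof (intro allI impI)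
  fix B :: "'a set"
  assume "bounded B"
  then have "bounded (uminus ` B)" by simp
  moreover have "blinfun_apply (- A) ` B = blinfun_apply A ` uminus ` B"
    by (simp add: image_image blinfun.minus_left blinfun.minus_right)
  ultimately show "compact (closure (blinfun_apply (- A) ` B))"
    using assms by (simp add: compact_operator_def)
qed

section \<open>One-sided Birkhoff--James orthogonality\<close>

text \<open>Only the half \<open>c \<ge> 0\<close> gets a name: the other half is the same relation
  with \<open>- y\<close>, so each result about it serves both.\<close>

definition birkhoff_plus :: "'a::real_normed_vector \<Rightarrow> 'a \<Rightarrow> bool" where
  "birkhoff_plus x y \<longleftrightarrow> (\<forall>c\<ge>0. norm (x + c *\<^sub>R y) \<ge> norm x)"

lemma birkhoff_orthogonal_iff: "x \<bottom>\<^sub>B y \<longleftrightarrow> birkhoff_plus x y \<and> birkhoff_plus x (- y)"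
proof -
  have "norm x \<le> norm (x + c *\<^sub>R y)" if "birkhoff_plus x y" "birkhoff_plus x (- y)" for c
    using that(1)[unfolded birkhoff_plus_def, rule_format, of c]
      that(2)[unfolded birkhoff_plus_def, rule_format, of "- c"]
    by (cases "c \<ge> 0") auto
  moreover have "birkhoff_plus x (- y)" if "x \<bottom>\<^sub>B y"
    unfolding birkhoff_plus_def
  proof (intro allI impI)
    fix c :: real
    show "norm x \<le> norm (x + c *\<^sub>R - y)"
      using that[unfolded birkhoff_orthogonal_def, rule_format, of "- c"] by simp
  qed
  ultimately show ?thesis
    by (auto simp: birkhoff_orthogonal_def birkhoff_plus_def)
qed

lemma birkhoff_plus_uminus: "birkhoff_plus (- x) (- y) \<longleftrightarrow> birkhoff_plus x y"
proof -
  have "norm (- x + c *\<^sub>R - y) = norm (x + c *\<^sub>R y)" for c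
    by (metis minus_add_distrib norm_minus_cancel scaleR_minus_right)
  then show ?thesis by (simp add: birkhoff_plus_def)
qed

text \<open>Monotonicity of the difference quotients of the convex function
  \<open>s \<mapsto> norm (x + s *\<^sub>R y)\<close> at zero, with denominators cleared.\<close>

lemma norm_add_scaleR_convex:
  fixes x y :: "'a::real_normed_vector"
  assumes "0 < s" "s \<le> c"
  shows "c * (norm (x + s *\<^sub>R y) - norm x) \<le> s * (norm (x + c *\<^sub>R y) - norm x)"
proof -
  have "c * norm (x + s *\<^sub>R y) = norm (c *\<^sub>R (x + s *\<^sub>R y))"
    using assms by simp
  also have "c *\<^sub>R (x + s *\<^sub>R y) = (c - s) *\<^sub>R x + s *\<^sub>R (x + c *\<^sub>R y)"
    by (simp add: algebra_simps)
  also have "norm \<dots> \<le> (c - s) * norm x + s * norm (x + c *\<^sub>R y)"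
    using assms norm_triangle_ineq[of "(c - s) *\<^sub>R x" "s *\<^sub>R (x + c *\<^sub>R y)"] by simp
  finally show ?thesis by (simp add: algebra_simps)
qed

text \<open>If both fail, \<open>x\<close> is a convex combination of
  \<open>x + c *\<^sub>R y\<close> and \<open>x - d *\<^sub>R y\<close>, two vectors of smaller norm
  than \<open>x\<close>.\<close>

lemma birkhoff_plus_or_minus: "birkhoff_plus x y \<or> birkhoff_plus x (- y)"
proof (rule ccontr)
  assume "\<not> ?thesis"
  then obtain c d where c: "c \<ge> 0" "norm (x + c *\<^sub>R y) < norm x"
    and d: "d \<ge> 0" "norm (x - d *\<^sub>R y) < norm x"
    by (auto simp: birkhoff_plus_def not_le)
  have pos: "c > 0" "d > 0"
    using c d by (auto simp: less_le)
  have "(c + d) * norm x = norm (d *\<^sub>R (x + c *\<^sub>R y) + c *\<^sub>R (x - d *\<^sub>R y))"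
    using pos by (simp add: algebra_simps flip: scaleR_add_left)
  also have "\<dots> \<le> d * norm (x + c *\<^sub>R y) + c * norm (x - d *\<^sub>R y)"
    using pos norm_triangle_ineq[of "d *\<^sub>R (x + c *\<^sub>R y)" "c *\<^sub>R (x - d *\<^sub>R y)"] by simp
  also have "\<dots> < d * norm x + c * norm x"
    using pos c d by (intro add_strict_mono mult_strict_left_mono)
  finally show False by (simp add: algebra_simps)
qed

lemma closed_birkhoff_plus:
  fixes T A :: "'a::real_normed_vector \<Rightarrow>\<^sub>L 'b::real_normed_vector"
  shows "closed {x. birkhoff_plus (T x) (A x)}"
proof -
  have "{x. birkhoff_plus (T x) (A x)} = (\<Inter>c\<in>{0..}. {x. norm (T x) \<le> norm (T x + c *\<^sub>R A x)})"
    by (auto simp: birkhoff_plus_def)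
  also have "closed \<dots>"
    by (intro closed_INT ballI closed_Collect_le continuous_intros)
  finally show ?thesis .
qed

section \<open>Norm attainment from one-sided orthogonality\<close>

lemma blinfun_almost_norming:
  fixes S :: "'a::real_normed_vector \<Rightarrow>\<^sub>L 'b::real_normed_vector"
  assumes e: "e > 0"
  shows "\<exists>x. norm x \<le> 1 \<and> norm S - e \<le> norm (S x)"
proof (rule ccontr)
  assume *: "\<not> ?thesis"
  have less: "norm (S x) < norm S - e" if "norm x \<le> 1" for x
    using that * by (meson not_le)
  \<comment> \<open>The witness is sought in the closed ball, so \<open>0\<close> is a candidate;
    this gives the sign condition of \<open>norm_blinfun_bound\<close>.\<close>
  have nonneg: "0 \<le> norm S - e"
    using less[of 0] by simp
  have "norm S \<le> norm S - e"
  proof (rule norm_blinfun_bound[OF nonneg])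
    fix x
    show "norm (S x) \<le> (norm S - e) * norm x"
    proof (cases "x = 0")
      case False
      then have "norm (S (x /\<^sub>R norm x)) < norm S - e"
        by (intro less) simp
      with False show ?thesis
        by (simp add: blinfun.scaleR_right field_simps)
    qed simp
  qed
  with e show False by simp
qed

text \<open>A first-order argument: near maximizers of \<open>T + e n *\<^sub>R A\<close> satisfy
  the inequality at the small step \<open>e n\<close>, and convexity carries it to every fixed
  \<open>c > 0\<close> in the limit.\<close>

lemma birkhoff_plus_norm_attaining:
  fixes T A :: "'a::real_normed_vector \<Rightarrow>\<^sub>L 'b::real_normed_vector"
  assumes reflexive: "reflexive_space TYPE('a)"
    and T: "compact_operator T" and A: "compact_operator A"
    and nz: "T \<noteq> 0" and orth: "birkhoff_plus T A"
  shows "\<exists>x\<in>norm_attainment_set T. birkhoff_plus (T x) (A x)"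
proof -
  define e where "e n = inverse (real (Suc n))" for n
  have e: "e n > 0" for n by (simp add: e_def)
  \<comment> \<open>The accuracy is quadratic in \<open>e n\<close> because it is later divided by
    \<open>e n\<close> and must still tend to zero.\<close>
  have "\<exists>x. norm x \<le> 1 \<and> norm (T + e n *\<^sub>R A) - (e n)\<^sup>2 \<le> norm ((T + e n *\<^sub>R A) x)" for n
    by (rule blinfun_almost_norming) (simp add: e less_imp_neq[symmetric])
  then obtain x where x: "\<And>n. norm (x n) \<le> 1"
    and x_max: "\<And>n. norm (T + e n *\<^sub>R A) - (e n)\<^sup>2 \<le> norm ((T + e n *\<^sub>R A) (x n))"
    by metis
  have x_ge: "norm T - (e n)\<^sup>2 \<le> norm (T (x n) + e n *\<^sub>R A (x n))" for n
  proof -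
    have "norm T \<le> norm (T + e n *\<^sub>R A)"
      using orth e[of n] by (simp add: birkhoff_plus_def)
    with x_max[of n] show ?thesis
      by (simp add: blinfun.add_left blinfun.scaleR_left)
  qed
  obtain u s where s: "strict_mono (s :: nat \<Rightarrow> nat)" and u: "(\<lambda>n. T (x (s n))) \<longlonglongrightarrow> u"
    using compact_operator_subsequence[OF T, of x 1] x by blast
  obtain v t where t: "strict_mono (t :: nat \<Rightarrow> nat)" and v: "(\<lambda>n. A (x (s (t n)))) \<longlonglongrightarrow> v"
    using compact_operator_subsequence[OF A, of "\<lambda>n. x (s n)" 1] x by blast
  define k where "k = s \<circ> t"
  define y where "y n = x (k n)" for n
  have k: "strict_mono k"
    unfolding k_def by (rule strict_mono_o[OF s t])
  have "e \<longlonglongrightarrow> 0"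
    unfolding e_def by (rule LIMSEQ_inverse_real_of_nat)
  from LIMSEQ_subseq_LIMSEQ[OF this k] have ek: "(\<lambda>n. e (k n)) \<longlonglongrightarrow> 0"
    by (simp add: o_def)
  have Ty: "(\<lambda>n. T (y n)) \<longlonglongrightarrow> u"
    using LIMSEQ_subseq_LIMSEQ[OF u t] by (simp add: y_def k_def o_def)
  have Ay: "(\<lambda>n. A (y n)) \<longlonglongrightarrow> v"
    using v by (simp add: y_def k_def)
  obtain z where z: "norm z \<le> 1"
    and weak: "\<And>(f :: 'a \<Rightarrow>\<^sub>L real) l. (\<lambda>n. blinfun_apply f (y n)) \<longlonglongrightarrow> l \<Longrightarrow> blinfun_apply f z = l"
    using reflexive_weak_cluster_point[OF reflexive, of y 1] x by (auto simp: y_def)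
  have Tz: "T z = u" and Az: "A z = v"
    using blinfun_apply_eq_limit[OF weak] Ty Ay by blast+
  have "norm T \<le> norm (T z)"
  proof (rule LIMSEQ_le)
    show "(\<lambda>n. norm T - (e (k n))\<^sup>2) \<longlonglongrightarrow> norm T"
      using tendsto_diff[OF tendsto_const tendsto_power[OF ek, of 2]] by simp
    show "(\<lambda>n. norm (T (y n) + e (k n) *\<^sub>R A (y n))) \<longlonglongrightarrow> norm (T z)"
      using tendsto_norm[OF tendsto_add[OF Ty tendsto_scaleR[OF ek Ay]]] by (simp add: Tz)
    show "\<exists>N. \<forall>n\<ge>N. norm T - (e (k n))\<^sup>2 \<le> norm (T (y n) + e (k n) *\<^sub>R A (y n))"
      using x_ge by (auto simp: y_def)
  qed
  moreover have "norm (T z) \<le> norm T * norm z"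
    by (rule norm_blinfun)
  moreover have "norm T * norm z \<le> norm T"
    using mult_left_mono[OF z norm_ge_zero[of T]] by simp
  \<comment> \<open>The chain of inequalities closes up; cancelling \<open>norm T\<close>, nonzero
    by \<open>nz\<close>, then gives \<open>norm z = 1\<close>.\<close>
  ultimately have "norm (T z) = norm T" "norm T * norm z = norm T"
    by linarith+
  then have "z \<in> norm_attainment_set T"
    using nz by (simp add: norm_attainment_set_def)
  moreover have "birkhoff_plus (T z) (A z)"
    unfolding birkhoff_plus_def
  proof (intro allI impI)
    fix c :: real
    assume "c \<ge> 0"
    show "norm (T z) \<le> norm (T z + c *\<^sub>R A z)"
    proof (cases "c = 0")
      case False
      with \<open>c \<ge> 0\<close> have c: "c > 0" by simp
      show ?thesis
      proof (rule tendsto_le[OF sequentially_bot])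
        show "(\<lambda>n. norm (T (y n) + c *\<^sub>R A (y n))) \<longlonglongrightarrow> norm (T z + c *\<^sub>R A z)"
          unfolding Tz Az by (intro tendsto_intros Ty Ay)
        \<comment> \<open>The loss \<open>c * e (k n)\<close> is the quadratic error enlarged by the
          convexity factor \<open>c / e (k n)\<close>.\<close>
        show "(\<lambda>n. norm (T (y n)) - c * e (k n)) \<longlonglongrightarrow> norm (T z)"
          using tendsto_diff[OF tendsto_norm[OF Ty] tendsto_mult[OF tendsto_const[of c] ek]]
          by (simp add: Tz)
        \<comment> \<open>The convexity estimate goes from a smaller step to a larger one, so
          \<open>e (k n)\<close> has to be at most \<open>c\<close>.\<close>
        have "\<forall>\<^sub>F n in sequentially. e (k n) < c"
          by (rule order_tendstoD(2)[OF ek c])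
        then show "\<forall>\<^sub>F n in sequentially. norm (T (y n)) - c * e (k n) \<le> norm (T (y n) + c *\<^sub>R A (y n))"
        proof eventually_elim
          case (elim n)
          let ?d = "e (k n)"
          have d: "?d > 0" by (rule e)
          have "norm (T (y n)) \<le> norm T * norm (y n)"
            by (rule norm_blinfun)
          also have "\<dots> \<le> norm T"
            using mult_left_mono[OF x norm_ge_zero[of T]] by (simp add: y_def)
          finally have "- ?d\<^sup>2 \<le> norm (T (y n) + ?d *\<^sub>R A (y n)) - norm (T (y n))"
            using x_ge[of "k n"] by (simp add: y_def)
          then have "c * (- ?d\<^sup>2) \<le> c * (norm (T (y n) + ?d *\<^sub>R A (y n)) - norm (T (y n)))"
            using c by (intro mult_left_mono) auto
          also have "\<dots> \<le> ?d * (norm (T (y n) + c *\<^sub>R A (y n)) - norm (T (y n)))"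
            using d elim by (intro norm_add_scaleR_convex) auto
          finally have "?d * (- (c * ?d)) \<le> ?d * (norm (T (y n) + c *\<^sub>R A (y n)) - norm (T (y n)))"
            by (simp add: power2_eq_square mult_ac)
          then have "- (c * ?d) \<le> norm (T (y n) + c *\<^sub>R A (y n)) - norm (T (y n))"
            using d by (simp only: mult_le_cancel_left_pos)
          then show ?case by simp
        qed
      qed
    qed simp
  qed
  ultimately show ?thesis by blast
qed

section \<open>Orthogonality of compact operators through a point of norm attainment\<close>

theorem theorem2p2:
  fixes T A :: "'a::banach \<Rightarrow>\<^sub>L 'b::banach"
  assumes nontrivial: "\<exists>x::'a. x \<noteq> 0"
    and reflexive: "reflexive_space TYPE('a)"
    and compact_T: "compact_operator T"
    and compact_A: "compact_operator A"
    and cases: "connected (norm_attainment_set T) \<or>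
      (\<not> connected (norm_attainment_set T) \<and>
        (\<exists>D. D \<noteq> {} \<and> connected D \<and> D \<subseteq> sphere 0 1 \<and>
             norm_attainment_set T = D \<union> uminus ` D))"
  shows "T \<bottom>\<^sub>B A \<longleftrightarrow>
    (\<exists>x \<in> norm_attainment_set T. blinfun_apply T x \<bottom>\<^sub>B blinfun_apply A x)"
proof
  assume "\<exists>x \<in> norm_attainment_set T. blinfun_apply T x \<bottom>\<^sub>B blinfun_apply A x"
  then obtain x where x: "norm x = 1" "norm (T x) = norm T" "T x \<bottom>\<^sub>B A x"
    by (auto simp: norm_attainment_set_def)
  show "T \<bottom>\<^sub>B A"
    unfolding birkhoff_orthogonal_def
  proof
    fix c :: real
    have "norm T \<le> norm (T x + c *\<^sub>R A x)"
      using x by (simp add: birkhoff_orthogonal_def)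
    also have "\<dots> \<le> norm (T + c *\<^sub>R A)"
      using norm_blinfun[of "T + c *\<^sub>R A" x] x(1) by (simp add: blinfun.add_left blinfun.scaleR_left)
    finally show "norm T \<le> norm (T + c *\<^sub>R A)" .
  qed
next
  assume orth: "T \<bottom>\<^sub>B A"
  show "\<exists>x \<in> norm_attainment_set T. blinfun_apply T x \<bottom>\<^sub>B blinfun_apply A x"
  proof (cases "T = 0")
    case True
    \<comment> \<open>For \<open>T = 0\<close> every unit vector attains the norm and zero is
      orthogonal to everything; \<open>nontrivial\<close> provides a unit vector.\<close>
    obtain x :: 'a where "x \<noteq> 0"
      using nontrivial by blast
    then have "x /\<^sub>R norm x \<in> norm_attainment_set T"
      using True by (simp add: norm_attainment_set_def)
    then show ?thesis
      using True by (auto simp: birkhoff_orthogonal_def)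
  next
    case False
    define P where "P = {x. birkhoff_plus (T x) (A x)}"
    define N where "N = {x. birkhoff_plus (T x) ((- A) x)}"
    have closed: "closed P" "closed N"
      unfolding P_def N_def by (rule closed_birkhoff_plus)+
    have cover: "x \<in> P \<or> x \<in> N" for x
      using birkhoff_plus_or_minus by (simp add: P_def N_def blinfun.minus_left)
    have sym: "- x \<in> P \<longleftrightarrow> x \<in> P" "- x \<in> N \<longleftrightarrow> x \<in> N" for x
      by (simp_all add: P_def N_def blinfun.minus_right birkhoff_plus_uminus)
    have meet: "P \<inter> norm_attainment_set T \<noteq> {}" "N \<inter> norm_attainment_set T \<noteq> {}"
      using birkhoff_plus_norm_attaining[OF reflexive compact_T compact_A False]
        birkhoff_plus_norm_attaining[OF reflexive compact_T compact_operator_uminus[OF compact_A] False]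
        orth
      by (auto simp: birkhoff_orthogonal_iff P_def N_def)
    \<comment> \<open>Both cases are treated at once: when the attainment set is connected, it
      serves as \<open>D\<close> itself.\<close>
    obtain D where D: "connected D" "D \<subseteq> norm_attainment_set T"
      and D_sym: "norm_attainment_set T \<subseteq> D \<union> uminus ` D"
      using cases by blast
    \<comment> \<open>A point of \<open>P\<close> or \<open>N\<close> in the attainment set lies in
      \<open>D\<close> or in its reflection; in the latter case its negative lies in
      \<open>D\<close> and in the same set by \<open>sym\<close>.\<close>
    have "P \<inter> D \<noteq> {}" "N \<inter> D \<noteq> {}"
      using meet D_sym sym by blast+
    \<comment> \<open>Two closed sets that cover the connected set \<open>D\<close> and both meet it
      cannot be disjoint on \<open>D\<close>.\<close>
    then have "P \<inter> N \<inter> D \<noteq> {}"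
      using D(1) closed cover unfolding connected_closed by blast
    with D(2) show ?thesis
      by (auto simp: birkhoff_orthogonal_iff P_def N_def blinfun.minus_left)
  qed
qed

end
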